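(* Let $F$ be a field of characteristic $0$, and let $\alpha_{1,0},\alpha_{1,1},\alpha_{1,2}\in F$ be pairwise distinct such that $2\alpha_{1,1}\neq\alpha_{1,0}+\alpha_{1,2}$. Let $R$ be a monomial linear operator on $F[x,y]$ of the form $R(x^n y^m) = \alpha_{n,m}y^{n+m}$ ($n,m\in\mathbb{N}$), where $\alpha_{0,l}=-1$ for all $l>0$, $\alpha_{0,0}\in\{0,-1\}$, and the remaining coefficients $\alpha_{n,m}\in F$ are expressed via $\alpha_{1,0},\alpha_{1,1},\alpha_{1,2}$ by the formulas $$\alpha_{1,m} = \frac{\alpha_{1,0}\alpha_{1,m-1} - \alpha_{1,1}\alpha_{1,m-2}}{\alpha_{1,0} + \alpha_{1,m-1} - (\alpha_{1,1} + \alpha_{1,m-2})}\qquad (m>2)$$ (where the denominators are nonzero) and $$\alpha_{k + 1,m} = \alpha_{k,m}(\alpha_{1,0}-\alpha_{1,k+m}) - \alpha_{1,0}\alpha_{k,m + 1}\qquad (k\geq 1,\ m\geq 0).$$ Then $R$ is a Rota--Baxter operator of weight $1$ on $F[x,y]$.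
   Context: $\mathbb{N}=\{0,1,2,\ldots\}$. A linear operator $R$ on an algebra $A$ over $F$ is a Rota--Baxter operator of weight $\lambda\in F$ if $R(a)R(b)=R\big(R(a)b+aR(b)+\lambda ab\big)$ for all $a,b\in A$. A linear operator on $F[x,y]$ is called monomial if it maps every monomial to a scalar (possibly zero) multiple of a monomial. *)

theory Defs
  imports "HOL-Computational_Algebra.Polynomial"
begin

text \<open>
  The algebra \<open>F[x,y]\<close> is the type \<open>'a poly poly\<close>, read as \<open>F[x][y]\<close>: the inner
  indeterminate is \<open>x\<close>, the outer one is \<open>y\<close>, and \<open>c \<in> F\<close> embeds as \<open>[:[:c:]:]\<close>.
\<close>

type_synonym 'a poly2 = "'a poly poly"

definition X :: "'a::field poly2" where
  "X = [:[:0, 1:]:]"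

definition Y :: "'a::field poly2" where
  "Y = [:0, 1:]"

definition scale2 :: "'a::field \<Rightarrow> 'a poly2 \<Rightarrow> 'a poly2" where
  "scale2 c p = smult [:c:] p"

definition linear_operator :: "('a::field poly2 \<Rightarrow> 'a poly2) \<Rightarrow> bool" where
  "linear_operator R \<longleftrightarrow> Vector_Spaces.linear scale2 scale2 R"

definition monomial_operator :: "('a::field poly2 \<Rightarrow> 'a poly2) \<Rightarrow> bool" where
  "monomial_operator R \<longleftrightarrow>
     (\<forall>n m. \<exists>c i j. R (X ^ n * Y ^ m) = scale2 c (X ^ i * Y ^ j))"

definition rota_baxter_operator :: "'a::field \<Rightarrow> ('a poly2 \<Rightarrow> 'a poly2) \<Rightarrow> bool" where
  "rota_baxter_operator w R \<longleftrightarrow>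
     linear_operator R \<and>
     (\<forall>a b. R a * R b = R (R a * b + a * R b + scale2 w (a * b)))"

lemma vector_space_scale2: "vector_space (scale2 :: 'a::field \<Rightarrow> 'a poly2 \<Rightarrow> 'a poly2)"
proof
  fix a b :: 'a and p q :: "'a poly2"
  show "scale2 a (p + q) = scale2 a p + scale2 a q"
    by (simp add: scale2_def smult_add_right)
  have "[:a + b:] = [:a:] + [:b:]" by simp
  then show "scale2 (a + b) p = scale2 a p + scale2 b p"
    unfolding scale2_def by (metis smult_add_left)
  show "scale2 a (scale2 b p) = scale2 (a * b) p"
    by (simp add: scale2_def mult.commute)
  show "scale2 1 p = p"
    by (simp add: scale2_def flip: one_pCons)
qed

lemma monomial_eq_monom:
  "(X :: 'a::field poly2) ^ n * Y ^ m = monom (monom 1 n) m"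
proof -
  have "(X :: 'a poly2) ^ n = [:monom 1 n:]"
    by (induction n) (simp_all add: X_def one_pCons monom_Suc monom_0)
  moreover have "(Y :: 'a poly2) ^ m = monom 1 m"
    by (simp add: Y_def monom_altdef)
  ultimately show ?thesis
    by (simp add: smult_monom)
qed

end

theory Submission
  imports Defs
begin

text \<open>
  Write \<open>a * b = R(a)b + aR(b) + ab\<close> for the star product of \<open>R\<close>, and let the defect
  \<open>E(a,b) = R(a)R(b) - R(a * b)\<close> measure the failure of the Rota--Baxter identity of weight \<open>1\<close>.
  The star product is associative up to defects, so \<open>E(a * b, c) = E(a, b * c)\<close> as soon as
  \<open>E(a,b) = E(b,c) = 0\<close> (\<open>defect_star_assoc\<close>). This turns the identity on all
  pairs of monomials into its special cases of low degree in \<open>x\<close>.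

  The values \<open>\<alpha>\<^sub>0\<^sub>,\<^sub>m\<close> of row \<open>0\<close> give \<open>E(y\<^sup>m, _) = 0\<close>, and then the recursion for the rows
  \<open>k + 1\<close> says exactly that \<open>E(x, _) = 0\<close>. Since \<open>x\<^sup>k\<^sup>+\<^sup>1y\<^sup>m\<close> is \<open>x * x\<^sup>ky\<^sup>m\<close> up to terms of lower
  degree in \<open>x\<close>, induction on \<open>k\<close> shows that \<open>E(_, c)\<close> vanishes identically once it vanishes on
  the \<open>y\<^sup>m\<close> and the \<open>xy\<^sup>m\<close> (\<open>defect_eq_0_from_rows_0_1\<close>). Using this for
  \<open>c = xy\<^sup>d\<close> and then, by symmetry, for arbitrary \<open>c\<close> leaves only \<open>E(xy\<^sup>b, xy\<^sup>d) = 0\<close>.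

  With \<open>f(n) = \<alpha>\<^sub>1\<^sub>,\<^sub>n\<close> and \<open>N = b + d\<close>, this last case says that
  \<open>(f(b) - f(N+1))(f(d) - f(N+1))\<close> depends on \<open>N\<close> only. The recursion for \<open>f\<close> is the
  equality of the values at \<open>(0,N)\<close> and \<open>(1,N-1)\<close>. It forces \<open>f\<close> to be the orbit
  \<open>\<infinity> \<mapsto> f(0) \<mapsto> f(1) \<mapsto> \<dots>\<close> of a Moebius transformation, hence a quotient of consecutive
  terms of a Lucas sequence, and d'Ocagne's identity evaluates the product
  (\<open>row_one_products\<close>).
\<close>

section \<open>The star product and the Rota--Baxter defect\<close>

definition star :: "('b::comm_ring \<Rightarrow> 'b) \<Rightarrow> 'b \<Rightarrow> 'b \<Rightarrow> 'b" where
  "star R a b = R a * b + a * R b + a * b"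

definition defect :: "('b::comm_ring \<Rightarrow> 'b) \<Rightarrow> 'b \<Rightarrow> 'b \<Rightarrow> 'b" where
  "defect R a b = R a * R b - R (star R a b)"

lemma star_commute: "star R a b = star R b a"
  by (simp add: star_def algebra_simps)

lemma defect_commute: "defect R a b = defect R b a"
  by (simp add: defect_def star_commute[of R a b] mult.commute)

text \<open>
  For a Rota--Baxter operator the star product is associative, and this is the reason: the
  associator is a combination of the two defects of neighbouring factors.
\<close>

lemma star_associator:
  "star R (star R a b) c - star R a (star R b c) = a * defect R b c - defect R a b * c"
  by (simp add: star_def defect_def algebra_simps)

text \<open>
  Both sides are \<open>R(a)R(b)R(c)\<close> minus \<open>R\<close> of the same triple star product.
\<close>

lemma defect_star_assoc:
  assumes "defect R a b = 0" and "defect R b c = 0"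
  shows "defect R (star R a b) c = defect R a (star R b c)"
proof -
  have "star R (star R a b) c = star R a (star R b c)"
    using star_associator[of R a b c] assms by simp
  moreover have "R (star R a b) = R a * R b" "R (star R b c) = R b * R c"
    using assms by (simp_all add: defect_def)
  ultimately show ?thesis
    by (simp add: defect_def mult.assoc)
qed

section \<open>Linear operators on the polynomial ring\<close>

lemma linear_operator_add: "linear_operator R \<Longrightarrow> R (p + q) = R p + R q"
  by (simp add: linear_operator_def Vector_Spaces.linear_def module_hom_def module_hom_axioms_def)

lemma linear_operator_scale: "linear_operator R \<Longrightarrow> R (scale2 c p) = scale2 c (R p)"
  by (simp add: linear_operator_def Vector_Spaces.linear_def module_hom_def module_hom_axioms_def)

lemma scale2_mult_left: "scale2 c p * q = scale2 c (p * q)"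
  and scale2_mult_right: "p * scale2 c q = scale2 c (p * q)"
  by (simp_all add: scale2_def)

lemma scale2_scale2: "scale2 c (scale2 d p) = scale2 (c * d) p"
  by (simp add: scale2_def mult.commute)

lemma scale2_add_right: "scale2 c (p + q) = scale2 c p + scale2 c q"
  by (simp add: scale2_def smult_add_right)

lemma scale2_add_left: "scale2 (c + d) p = scale2 c p + scale2 d p"
  by (simp add: scale2_def flip: smult_add_left)

lemma scale2_diff_left: "scale2 (c - d) p = scale2 c p - scale2 d p"
  by (simp add: scale2_def flip: smult_diff_left)

lemma scale2_zero_left: "scale2 0 p = 0"
  by (simp add: scale2_def)

lemma scale2_zero_right: "scale2 c 0 = 0"
  by (simp add: scale2_def)

lemma scale2_one_left: "scale2 1 p = p"
  by (simp add: scale2_def flip: one_pCons)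

lemma defect_add_left:
  assumes "linear_operator R"
  shows "defect R (p + q) c = defect R p c + defect R q c"
  by (simp add: defect_def star_def linear_operator_add[OF assms] algebra_simps)

lemma defect_add_right:
  assumes "linear_operator R"
  shows "defect R c (p + q) = defect R c p + defect R c q"
  by (simp only: defect_commute[of R c] defect_add_left[OF assms])

lemma defect_scale_left:
  assumes "linear_operator R"
  shows "defect R (scale2 t p) c = scale2 t (defect R p c)"
proof -
  have "star R (scale2 t p) c = scale2 t (star R p c)"
    by (simp add: star_def linear_operator_scale[OF assms] scale2_mult_left scale2_add_right)
  then show ?thesis
    by (simp add: defect_def linear_operator_scale[OF assms] scale2_mult_left)
       (simp add: scale2_def smult_diff_right)
qed

lemma defect_scale_right:
  assumes "linear_operator R"
  shows "defect R c (scale2 t p) = scale2 t (defect R c p)"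
  by (simp only: defect_commute[of R c] defect_scale_left[OF assms])

text \<open>
  A subspace of \<open>F[x,y]\<close> that contains the monomials is the whole space; it is used for the
  annihilators \<open>{u. E(u,c) = 0}\<close>.
\<close>

lemma poly2_induct_monomials:
  fixes P :: "'a::field poly2 \<Rightarrow> bool"
  assumes add: "\<And>p q. P p \<Longrightarrow> P q \<Longrightarrow> P (p + q)"
    and scale: "\<And>c p. P p \<Longrightarrow> P (scale2 c p)"
    and monomial: "\<And>n m. P (X ^ n * Y ^ m)"
  shows "P p"
proof -
  have "P (scale2 0 (X ^ 0 * Y ^ 0))"
    by (intro scale monomial)
  then have zero: "P 0"
    by (simp add: scale2_zero_left)
  have sum: "P (sum h A)" if "finite A" "\<And>i. i \<in> A \<Longrightarrow> P (h i)" for h :: "nat \<Rightarrow> 'a poly2" and A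
    using that by (induction rule: finite_induct) (auto intro: zero add)
  have monom: "P (monom q m)" for q m
  proof -
    have "monom q m = monom (\<Sum>i\<le>degree q. monom (coeff q i) i) m"
      by (simp add: poly_as_sum_of_monoms)
    also have "\<dots> = (\<Sum>i\<le>degree q. monom (monom (coeff q i) i) m)"
      by (simp add: monom_sum)
    also have "\<dots> = (\<Sum>i\<le>degree q. scale2 (coeff q i) (X ^ i * Y ^ m))"
      by (simp add: monomial_eq_monom scale2_def smult_monom)
    finally show ?thesis
      using sum[of "{..degree q}" "\<lambda>i. scale2 (coeff q i) (X ^ i * Y ^ m)"] scale monomial by simp
  qed
  have "P (\<Sum>i\<le>degree p. monom (coeff p i) i)"
    by (intro sum monom finite_atMost)
  then show ?thesis
    by (simp add: poly_as_sum_of_monoms)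
qed

lemma monomial_mult_monomial:
  "(X ^ a * Y ^ b) * (X ^ c * Y ^ d) = X ^ (a + c) * (Y ^ (b + d) :: 'a::field poly2)"
  by (simp add: power_add algebra_simps)

lemma star_monomials:
  fixes R :: "'a::field poly2 \<Rightarrow> 'a poly2"
  assumes "\<And>n m. R (X ^ n * Y ^ m) = scale2 (\<alpha> n m) (Y ^ (n + m))"
  shows "star R (X ^ a * Y ^ b) (X ^ c * Y ^ d) =
    scale2 (\<alpha> a b) (X ^ c * Y ^ (a + b + d)) + scale2 (\<alpha> c d) (X ^ a * Y ^ (b + c + d))
      + X ^ (a + c) * Y ^ (b + d)"
proof -
  have "Y ^ (a + b) * (X ^ c * Y ^ d) = X ^ c * (Y ^ (a + b + d) :: 'a poly2)"
    and "(X ^ a * Y ^ b) * Y ^ (c + d) = X ^ a * (Y ^ (b + c + d) :: 'a poly2)"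
    by (simp_all add: power_add algebra_simps)
  then show ?thesis
    unfolding star_def assms scale2_mult_left scale2_mult_right monomial_mult_monomial
    by (simp only:)
qed

text \<open>
  All terms of the defect of two monomials are multiples of the same power of \<open>y\<close>, so that the
  Rota--Baxter identity on monomials is a system of scalar equations for \<open>\<alpha>\<close>.
\<close>

lemma defect_monomials:
  fixes R :: "'a::field poly2 \<Rightarrow> 'a poly2"
  assumes "linear_operator R"
    and form: "\<And>n m. R (X ^ n * Y ^ m) = scale2 (\<alpha> n m) (Y ^ (n + m))"
  shows "defect R (X ^ a * Y ^ b) (X ^ c * Y ^ d) =
    scale2 (\<alpha> a b * \<alpha> c d
      - (\<alpha> a b * \<alpha> c (a + b + d) + \<alpha> c d * \<alpha> a (b + c + d) + \<alpha> (a + c) (b + d)))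
      (Y ^ (a + b + c + d))"
proof -
  have deg: "c + (a + b + d) = a + b + c + d" "a + (b + c + d) = a + b + c + d"
    "a + c + (b + d) = a + b + c + d"
    by simp_all
  have "R (X ^ a * Y ^ b) * R (X ^ c * Y ^ d) = scale2 (\<alpha> a b * \<alpha> c d) (Y ^ (a + b + c + d))"
    by (simp add: form scale2_mult_left scale2_mult_right scale2_scale2 power_add mult_ac)
  then show ?thesis
    unfolding defect_def star_monomials[where \<alpha> = \<alpha>, OF form]
      linear_operator_add[OF assms(1)] linear_operator_scale[OF assms(1)] form deg
    by (simp add: scale2_scale2 scale2_diff_left scale2_add_left)
qed

lemma linear_operator_rota_baxter_iff:
  assumes "linear_operator R"
  shows "rota_baxter_operator 1 R \<longleftrightarrow> (\<forall>a b. defect R a b = 0)"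
  using assms by (simp add: rota_baxter_operator_def defect_def star_def scale2_one_left)

text \<open>
  Where the operator satisfies \<open>E(x, _) = 0\<close>, the annihilator \<open>{u. E(u,c) = 0}\<close> is closed under
  \<open>u \<mapsto> x * u\<close>, because \<open>E(x * u, c) = E(x, u * c) = 0\<close>. As \<open>x * x\<^sup>ky\<^sup>m\<close> has the leading
  term \<open>x\<^sup>k\<^sup>+\<^sup>1y\<^sup>m\<close> in \<open>x\<close> for \<open>k \<ge> 1\<close>, the rows \<open>0\<close> and \<open>1\<close> of monomials generate
  everything. The step from row \<open>0\<close> to row \<open>1\<close> cannot be made in this way:
  \<open>x * y\<^sup>m = \<alpha>\<^sub>1\<^sub>,\<^sub>0y\<^sup>m\<^sup>+\<^sup>1\<close> if \<open>\<alpha>\<^sub>0\<^sub>,\<^sub>m = -1\<close>.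
\<close>

lemma defect_eq_0_from_rows_0_1:
  fixes R :: "'a::field poly2 \<Rightarrow> 'a poly2"
  assumes lin: "linear_operator R"
    and form: "\<And>n m. R (X ^ n * Y ^ m) = scale2 (\<alpha> n m) (Y ^ (n + m))"
    and X: "\<And>u. defect R X u = 0"
    and row0: "\<And>m. defect R (Y ^ m) c = 0"
    and row1: "\<And>m. defect R (X * Y ^ m) c = 0"
  shows "defect R u c = 0"
proof (rule poly2_induct_monomials[where P = "\<lambda>u. defect R u c = 0"])
  fix n m
  show "defect R (X ^ n * Y ^ m) c = 0"
  proof (induction n arbitrary: m)
    case 0
    then show ?case
      by (simp add: row0)
  next
    case (Suc k)
    show ?case
    proof (cases "k = 0")
      case True
      then show ?thesis
        by (simp add: row1)
    next
      case False
      let ?u = "X ^ k * Y ^ m"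
      have "star R X ?u = scale2 (\<alpha> 1 0) (X ^ k * Y ^ (m + 1))
          + scale2 (\<alpha> k m) (X * Y ^ (k + m)) + X ^ Suc k * Y ^ m"
        using star_monomials[where \<alpha> = \<alpha>, OF form, of 1 0 k m] by simp
      then have "defect R (star R X ?u) c = scale2 (\<alpha> 1 0) (defect R (X ^ k * Y ^ (m + 1)) c)
          + scale2 (\<alpha> k m) (defect R (X * Y ^ (k + m)) c) + defect R (X ^ Suc k * Y ^ m) c"
        by (simp only: defect_add_left[OF lin] defect_scale_left[OF lin])
      then have "defect R (star R X ?u) c = defect R (X ^ Suc k * Y ^ m) c"
        by (simp only: Suc.IH row1 scale2_zero_right add_0_left)
      moreover have "defect R (star R X ?u) c = defect R X (star R ?u c)"
        by (rule defect_star_assoc) (simp_all add: X Suc.IH)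
      ultimately show ?thesis
        by (simp add: X)
    qed
  qed
qed (simp_all add: defect_add_left[OF lin] defect_scale_left[OF lin] scale2_zero_right)

section \<open>The coefficients of the first row\<close>

text \<open>
  Up to the signs of the parameters, the Lucas sequence \<open>U\<^sub>n(-p, -c)\<close>.
\<close>

fun lucas :: "'a::comm_ring_1 \<Rightarrow> 'a \<Rightarrow> nat \<Rightarrow> 'a" where
  "lucas p c 0 = 0"
| "lucas p c (Suc 0) = 1"
| "lucas p c (Suc (Suc n)) = c * lucas p c n - p * lucas p c (Suc n)"

text \<open>
  D'Ocagne's identity: the determinant of two shifted pairs of terms is multiplied by \<open>-c\<close>, the
  determinant of the companion matrix of the recursion, when both indices move by one.
\<close>

lemma lucas_docagne:
  "lucas p c b * lucas p c (Suc (b + k)) - lucas p c (Suc b) * lucas p c (b + k)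
    = - ((- c) ^ b * lucas p c k)"
proof (induction b)
  case 0
  then show ?case by simp
next
  case (Suc b)
  have "lucas p c (Suc b) * lucas p c (Suc (Suc b + k)) - lucas p c (Suc (Suc b)) * lucas p c (Suc b + k)
    = - c * (lucas p c b * lucas p c (Suc (b + k)) - lucas p c (Suc b) * lucas p c (b + k))"
    by (simp add: algebra_simps)
  then show ?case
    by (simp add: Suc.IH)
qed

text \<open>
  Let \<open>w\<close> be the Lucas sequence.
  By d'Ocagne's identity the difference \<open>g(b) - g(b+d+1)\<close> has the numerator \<open>w(d+1)\<close> and
  the denominator \<open>w(b+1)\<close>, up to factors that are powers of \<open>-c\<close> or depend on \<open>b + d\<close> only.
  Multiplied with the difference for \<open>b\<close> and \<open>d\<close> exchanged, these two cancel.
\<close>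

lemma lucas_quotient_products:
  fixes g :: "nat \<Rightarrow> 'a::field"
  assumes nz: "\<And>n. lucas p c (Suc n) \<noteq> 0"
    and g: "\<And>n. g n = c * lucas p c n / lucas p c (Suc n)"
  shows "(g b - g (Suc (b + d))) * (g d - g (Suc (b + d)))
    = c\<^sup>2 * (- c) ^ (b + d) / (lucas p c (Suc (Suc (b + d))))\<^sup>2"
proof -
  let ?w = "lucas p c"
  have diff: "g b - g (Suc (b + d)) = - c * (- c) ^ b * ?w (Suc d) / (?w (Suc b) * ?w (Suc (Suc (b + d))))"
    for b d
  proof -
    have "g b - g (Suc (b + d)) =
        c * (?w b * ?w (Suc (Suc (b + d))) - ?w (Suc b) * ?w (Suc (b + d)))
          / (?w (Suc b) * ?w (Suc (Suc (b + d))))"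
      unfolding g using nz[of b] nz[of "Suc (b + d)"] by (simp add: field_simps del: lucas.simps)
    also have "?w b * ?w (Suc (Suc (b + d))) - ?w (Suc b) * ?w (Suc (b + d)) = - ((- c) ^ b * ?w (Suc d))"
      using lucas_docagne[of p c b "Suc d"] by (simp del: lucas.simps)
    finally show ?thesis
      by simp
  qed
  show ?thesis
    unfolding diff[of b d] diff[of d b, unfolded add.commute[of d b]]
    using nz[of b] nz[of d]
    by (simp add: power2_eq_square power_add divide_simps del: lucas.simps)
qed

text \<open>
  The Moebius transformation \<open>z \<mapsto> c/(z - p)\<close> acts on the fractions \<open>c w(n)/w(n+1)\<close> as a linear
  recursion of order two for the Lucas sequence \<open>w\<close>. No \<open>w(n+1)\<close> vanishes, since the orbit of \<open>0\<close> never meets the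
  pole \<open>p\<close>.
\<close>

lemma mobius_orbit_lucas:
  fixes g :: "nat \<Rightarrow> 'a::field"
  assumes "g 0 = 0" and c: "c \<noteq> 0"
    and step: "\<And>n. g (Suc n) * (g n - p) = c"
  shows "lucas p c (Suc n) \<noteq> 0" and "g n = c * lucas p c n / lucas p c (Suc n)"
proof -
  have "lucas p c (Suc n) \<noteq> 0 \<and> g n * lucas p c (Suc n) = c * lucas p c n"
  proof (induction n)
    case 0
    then show ?case by (simp add: assms(1))
  next
    case (Suc n)
    then have w: "lucas p c (Suc (Suc n)) = (g n - p) * lucas p c (Suc n)"
      by (simp add: algebra_simps)
    have "g n - p \<noteq> 0"
      using step[of n] c by auto
    moreover have "g (Suc n) * lucas p c (Suc (Suc n)) = c * lucas p c (Suc n)"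
      unfolding w by (simp flip: step[of n] add: mult.assoc)
    ultimately show ?case
      using Suc.IH w by (simp del: lucas.simps)
  qed
  then show "lucas p c (Suc n) \<noteq> 0" and "g n = c * lucas p c n / lucas p c (Suc n)"
    by (simp_all add: field_simps)
qed

text \<open>
  Here \<open>g(n) = f(n) - f(0)\<close> is the first row moved to start at \<open>0\<close>. The map
  \<open>z \<mapsto> -p g(1)/(z - p)\<close> sends \<open>\<infinity>\<close> to \<open>0\<close> and \<open>0\<close> to \<open>g(1)\<close>, and the value of \<open>p\<close> is the one
  for which it sends \<open>g(1)\<close> to \<open>g(2)\<close>. The recursion of order two, solved for \<open>g(n+1)\<close> from the
  previous two terms, preserves this relation of order one.
\<close>

lemma recurrence_mobius_orbit:
  fixes g :: "nat \<Rightarrow> 'a::field"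
  assumes "g 0 = 0" "g 1 \<noteq> g 2"
    and denom: "\<And>m. g (m + 2) \<noteq> g 1 + g (m + 1)"
    and rec: "\<And>m. g (m + 3) * (g (m + 2) - g 1 - g (m + 1)) = - (g 1 * g (m + 1))"
  defines "p \<equiv> g 1 * g 2 / (g 2 - g 1)"
  shows "g (Suc n) * (g n - p) = - (p * g 1)"
proof -
  have "g (n + 1) * (g n - p) = - (p * g 1)
    \<and> g (n + 2) * (g (n + 1) - p) = - (p * g 1)"
  proof (induction n)
    case 0
    have "g 2 * (g 1 - p) = - (p * g 1)"
      using assms(2) by (simp add: p_def divide_simps) (simp add: algebra_simps)
    then show ?case
      using assms(1) by (simp add: mult.commute numeral_2_eq_2)
  next
    case (Suc n)
    \<comment> \<open>The denominator in the recursion for the next term; it is cancelled at the end.\<close>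
    let ?D = "g (n + 2) - g 1 - g (n + 1)"
    have "?D \<noteq> 0"
      using denom[of n] by (auto simp: algebra_simps)
    moreover have "?D * (g (n + 3) * (g (n + 2) - p)) = ?D * (- (p * g 1))"
    proof -
      have "?D * (g (n + 3) * (g (n + 2) - p)) = g (n + 3) * ?D * (g (n + 2) - p)"
        by (simp only: mult_ac)
      also have "\<dots> = - (g 1 * g (n + 1)) * (g (n + 2) - p)"
        by (simp only: rec)
      also have "\<dots> = - g 1 * (g (n + 2) * (g (n + 1) - p) + p * g (n + 2) - p * g (n + 1))"
        by (simp add: algebra_simps)
      also have "g (n + 2) * (g (n + 1) - p) = - (p * g 1)"
        using Suc.IH by blast
      also have "- g 1 * (- (p * g 1) + p * g (n + 2) - p * g (n + 1)) = ?D * (- (p * g 1))"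
        by (simp add: algebra_simps)
      finally show ?thesis .
    qed
    ultimately have "g (n + 3) * (g (n + 2) - p) = - (p * g 1)"
      by (simp only: mult_cancel_left) simp
    then show ?case
      using Suc.IH by (simp add: eval_nat_numeral)
  qed
  then show ?thesis by simp
qed

text \<open>
  This is the Rota--Baxter identity for \<open>xy\<^sup>b\<close> and \<open>xy\<^sup>d\<close>, rewritten as a comparison with the
  pair \<open>x\<close>, \<open>xy\<^sup>b\<^sup>+\<^sup>d\<close>; the recursion is the instance \<open>b = 1\<close>. All differences are invariant under
  a translation of \<open>f\<close>, so \<open>f(0) = 0\<close> may be assumed and the Lucas quotients apply.
\<close>

lemma row_one_products:
  fixes f :: "nat \<Rightarrow> 'a::field"
  assumes distinct: "f 0 \<noteq> f 1" "f 0 \<noteq> f 2" "f 1 \<noteq> f 2"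
    and denom: "\<And>m. m > 2 \<Longrightarrow> f 0 + f (m - 1) - (f 1 + f (m - 2)) \<noteq> 0"
    and rec: "\<And>m. m > 2 \<Longrightarrow>
      f m = (f 0 * f (m - 1) - f 1 * f (m - 2)) / (f 0 + f (m - 1) - (f 1 + f (m - 2)))"
  shows "(f b - f (Suc (b + d))) * (f d - f (Suc (b + d)))
    = (f 0 - f (Suc (b + d))) * (f (b + d) - f (Suc (b + d)))"
proof -
  define g where "g n = f n - f 0" for n
  define p where "p = g 1 * g 2 / (g 2 - g 1)"
  define c where "c = - (p * g 1)"
  have g: "g 0 = 0" "g 1 \<noteq> 0" "g 2 \<noteq> 0" "g 1 \<noteq> g 2"
    using distinct by (auto simp: g_def)
  have D: "f 0 + f (m + 2) - (f 1 + f (m + 1)) \<noteq> 0" for m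
    using denom[of "m + 3"] by simp
  have f_rec: "f (m + 3) * (f 0 + f (m + 2) - (f 1 + f (m + 1))) = f 0 * f (m + 2) - f 1 * f (m + 1)" for m
    using rec[of "m + 3"] D[of m] by simp
  have g_rec: "g (m + 3) * (g (m + 2) - g 1 - g (m + 1)) = - (g 1 * g (m + 1))" for m
    using f_rec[of m] by (simp add: g_def algebra_simps)
  have g_denom: "g (m + 2) \<noteq> g 1 + g (m + 1)" for m
    using D[of m] by (auto simp: g_def algebra_simps)
  have step: "g (Suc n) * (g n - p) = c" for n
    unfolding c_def p_def by (rule recurrence_mobius_orbit[OF g(1) g(4) g_denom g_rec])
  have c: "c \<noteq> 0"
    using g by (simp add: c_def p_def)
  note orbit = mobius_orbit_lucas[of g c p, OF g(1) c step]
  have "(g b - g (Suc (b + d))) * (g d - g (Suc (b + d)))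
    = (g 0 - g (Suc (0 + (b + d)))) * (g (b + d) - g (Suc (0 + (b + d))))"
    \<comment> \<open>Writing \<open>0 + (b + d)\<close> makes both sides instances of the same closed formula.\<close>
    unfolding lucas_quotient_products[OF orbit] by simp
  then show ?thesis
    by (simp add: g_def)
qed

section \<open>The Rota--Baxter property\<close>

theorem theorem7p1:
  fixes \<alpha> :: "nat \<Rightarrow> nat \<Rightarrow> 'a::field_char_0"
    and R :: "'a poly2 \<Rightarrow> 'a poly2"
  assumes distinct: "\<alpha> 1 0 \<noteq> \<alpha> 1 1" "\<alpha> 1 0 \<noteq> \<alpha> 1 2" "\<alpha> 1 1 \<noteq> \<alpha> 1 2"
    and not_arith: "2 * \<alpha> 1 1 \<noteq> \<alpha> 1 0 + \<alpha> 1 2"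
    and lin: "linear_operator R"
    and mon: "monomial_operator R"
    and form: "\<And>n m. R (X ^ n * Y ^ m) = scale2 (\<alpha> n m) (Y ^ (n + m))"
    and row0: "\<And>l. l > 0 \<Longrightarrow> \<alpha> 0 l = -1"
    and zero: "\<alpha> 0 0 \<in> {0, -1}"
    and denom: "\<And>m. m > 2 \<Longrightarrow> \<alpha> 1 0 + \<alpha> 1 (m - 1) - (\<alpha> 1 1 + \<alpha> 1 (m - 2)) \<noteq> 0"
    and row1: "\<And>m. m > 2 \<Longrightarrow> \<alpha> 1 m =
      (\<alpha> 1 0 * \<alpha> 1 (m - 1) - \<alpha> 1 1 * \<alpha> 1 (m - 2)) /
      (\<alpha> 1 0 + \<alpha> 1 (m - 1) - (\<alpha> 1 1 + \<alpha> 1 (m - 2)))"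
    and rows: "\<And>k m. k \<ge> 1 \<Longrightarrow>
      \<alpha> (k + 1) m = \<alpha> k m * (\<alpha> 1 0 - \<alpha> 1 (k + m)) - \<alpha> 1 0 * \<alpha> k (m + 1)"
  shows "rota_baxter_operator 1 R"
proof -
  note dm = defect_monomials[where \<alpha> = \<alpha>, OF lin form]
  \<comment> \<open>The exponent \<open>m = 0\<close> is where \<open>\<alpha>\<^sub>0\<^sub>,\<^sub>0\<close> enters: it has to be minus an idempotent.\<close>
  have row0_defect_monomial: "defect R (Y ^ m) (X ^ c * Y ^ d) = 0" for m c d
  proof -
    have "\<alpha> 0 m * \<alpha> c d
        - (\<alpha> 0 m * \<alpha> c (m + d) + \<alpha> c d * \<alpha> 0 (m + c + d) + \<alpha> c (m + d)) = 0"
      using zero row0[of m] row0[of "m + c + d"] by (cases "m = 0"; cases "c = 0"; cases "d = 0") auto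
    then show ?thesis
      using dm[of 0 m c d] by (simp add: scale2_zero_left)
  qed
  have right_monomials: "defect R v u = 0" if "\<And>c d. defect R v (X ^ c * Y ^ d) = 0" for v u
    by (rule poly2_induct_monomials[where P = "\<lambda>u. defect R v u = 0"])
       (simp_all add: that defect_add_right[OF lin] defect_scale_right[OF lin] scale2_zero_right)
  have row0_defect: "defect R (Y ^ m) u = 0" for m u
    by (rule right_monomials) (rule row0_defect_monomial)
  have "defect R X (X ^ c * Y ^ d) = 0" for c d
  proof (cases "c = 0")
    case True
    then show ?thesis
      using row0_defect[of d X] by (simp add: defect_commute[of R X])
  next
    case False
    \<comment> \<open>The scalar equation is the recursion for row \<open>c + 1\<close>.\<close>
    then show ?thesis
      using dm[of 1 0 c d] rows[of c d] by (simp add: algebra_simps scale2_zero_left)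
  qed
  then have X_defect: "defect R X u = 0" for u
    by (rule right_monomials)
  have row1_row1: "defect R (X * Y ^ b) (X * Y ^ d) = 0" for b d
  proof -
    have row2: "\<alpha> (Suc 1) (b + d) = \<alpha> 1 (b + d) * (\<alpha> 1 0 - \<alpha> 1 (Suc (b + d))) - \<alpha> 1 0 * \<alpha> 1 (Suc (b + d))"
      using rows[of 1 "b + d"] by simp
    have "(\<alpha> 1 b - \<alpha> 1 (Suc (b + d))) * (\<alpha> 1 d - \<alpha> 1 (Suc (b + d)))
        = (\<alpha> 1 0 - \<alpha> 1 (Suc (b + d))) * (\<alpha> 1 (b + d) - \<alpha> 1 (Suc (b + d)))"
      by (rule row_one_products[OF distinct denom row1])
    then have "\<alpha> 1 b * \<alpha> 1 d - (\<alpha> 1 b * \<alpha> 1 (1 + b + d) + \<alpha> 1 d * \<alpha> 1 (b + 1 + d)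
        + \<alpha> (1 + 1) (b + d)) = 0"
      by (simp add: row2[simplified] algebra_simps)
    then show ?thesis
      using dm[of 1 b 1 d] by (simp only: power_one_right scale2_zero_left)
  qed
  \<comment> \<open>The reduction is used twice: first with \<open>xy\<^sup>b\<close> as the fixed argument, where \<open>row1_row1\<close> is
    its hypothesis, and then with any fixed argument, where the first result is.\<close>
  have row1_defect: "defect R (X * Y ^ b) u = 0" for b u
    by (subst defect_commute)
       (rule defect_eq_0_from_rows_0_1[where \<alpha> = \<alpha>, OF lin form X_defect row0_defect row1_row1])
  have "defect R u v = 0" for u v
    by (rule defect_eq_0_from_rows_0_1[where \<alpha> = \<alpha>, OF lin form X_defect row0_defect row1_defect])
  then show ?thesis
    by (simp add: linear_operator_rota_baxter_iff[OF lin])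
qed

end
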